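(* If $r$ is a $2n$-balanced rotor type, then $UD(r)\equiv_n DU(r)\equiv_n r$.
   Context: A rotor type is an infinite periodic sequence $r=(r^{(1)},r^{(2)},\dots)$ of states with fundamental period $|r|$; two rotor types are equivalent if one is obtained from the other by an injective relabeling of states. A two-state rotor type is written over $\{1,2\}$ (convention $r^{(1)}=1$). For $N\in\mathbb{N}$, a two-state rotor type $r$ is $N$-balanced if $N$ divides $|r|$ and for every $k\ge0$ the block $r^{(k,N)}=(r^{(kN+1)},\dots,r^{(kN+N)})$ contains equally many $1$'s and $2$'s. Two rotor types $r,r'$ are $n$-equivalent, $r\equiv_n r'$, if there is a rotor type $s$ equivalent to $r$ and using the same states as $r'$ such that for every $k\ge 0$ the blocks $r'^{(k,n)}$ and $s^{(k,n)}$ are equal as multisets. Rotor-router dynamics: at each non-target vertex $v$ there is a periodic sequence $e_v^{(1)},e_v^{(2)},\dots$ of out-edges; a particle starts at the source, on its $j$-th visit to $v$ leaves along $e_v^{(j)}$, and whenever it reaches a target it is returned to the source; the hitting sequence is the sequence of targets reached. The compressor for $r$ has non-target vertices $1$ (source), $2,3$ and targets $4,5$. On the $j$-th departure: from vertex $1$ the particle goes to vertex $2$ if $r^{(j)}=1$ and to vertex $3$ if $r^{(j)}=2$; from vertex $2$, in variant $U$ it goes to vertex $1$ if $r^{(j)}=1$ and to target $4$ if $r^{(j)}=2$, in variant $D$ to target $4$ if $r^{(j)}=1$ and to vertex $1$ if $r^{(j)}=2$; from vertex $3$ likewise with target $5$. $UD(r)$ (resp. $DU(r)$) is the hitting sequence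 with variant $U$ at vertex $2$ and $D$ at vertex $3$ (resp. $D$ at $2$ and $U$ at $3$), viewed as a rotor type. *)

theory Defs
  imports "HOL-Library.Multiset" "HOL-Library.Infinite_Set"
begin

text \<open>All sequences are indexed from 0, so \<open>r j\<close> is the state \<open>r^(j+1)\<close>.\<close>

definition rotor_type :: "(nat \<Rightarrow> 'a) \<Rightarrow> bool" where
  "rotor_type r \<longleftrightarrow> (\<exists>p>0. \<forall>i. r (i + p) = r i)"

definition fund_period :: "(nat \<Rightarrow> 'a) \<Rightarrow> nat" where
  "fund_period r = (LEAST p. p > 0 \<and> (\<forall>i. r (i + p) = r i))"

definition equiv_rotor :: "(nat \<Rightarrow> 'a) \<Rightarrow> (nat \<Rightarrow> 'b) \<Rightarrow> bool" where
  "equiv_rotor r s \<longleftrightarrow> (\<exists>f. inj_on f (range r) \<and> s = f \<circ> r)"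

definition two_state :: "(nat \<Rightarrow> nat) \<Rightarrow> bool" where
  "two_state r \<longleftrightarrow> rotor_type r \<and> range r = {1, 2} \<and> r 0 = 1"

definition block :: "(nat \<Rightarrow> 'a) \<Rightarrow> nat \<Rightarrow> nat \<Rightarrow> 'a list" where
  "block r k N = map r [k * N..<k * N + N]"

text \<open>For \<open>N = 0\<close> this never holds, as the fundamental period is positive.\<close>

definition balanced :: "nat \<Rightarrow> (nat \<Rightarrow> nat) \<Rightarrow> bool" where
  "balanced N r \<longleftrightarrow> two_state r \<and> N dvd fund_period r \<and>
     (\<forall>k. count_list (block r k N) 1 = count_list (block r k N) 2)"

definition n_equiv :: "nat \<Rightarrow> (nat \<Rightarrow> 'a) \<Rightarrow> (nat \<Rightarrow> 'b) \<Rightarrow> bool" where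
  "n_equiv n r r' \<longleftrightarrow> rotor_type r \<and> rotor_type r' \<and>
     (\<exists>s. rotor_type s \<and> equiv_rotor r s \<and> range s = range r' \<and>
          (\<forall>k. mset (block r' k n) = mset (block s k n)))"

text \<open>
  A configuration is the position of the particle together with the number of
  departures made so far from each vertex; \<open>e v j\<close> is the head of the \<open>(j+1)\<close>-st
  out-edge of \<open>v\<close>. The return from a target to the source takes one step.
\<close>

definition rotor_step ::
  "'v \<Rightarrow> 'v set \<Rightarrow> ('v \<Rightarrow> nat \<Rightarrow> 'v) \<Rightarrow> 'v \<times> ('v \<Rightarrow> nat) \<Rightarrow> 'v \<times> ('v \<Rightarrow> nat)" where
  "rotor_step s T e = (\<lambda>(v, c).
     if v \<in> T then (s, c) else (e v (c v), c(v := Suc (c v))))"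

definition rotor_walk :: "'v \<Rightarrow> 'v set \<Rightarrow> ('v \<Rightarrow> nat \<Rightarrow> 'v) \<Rightarrow> nat \<Rightarrow> 'v" where
  "rotor_walk s T e t = fst ((rotor_step s T e ^^ t) (s, \<lambda>_. 0))"

text \<open>
  Meaningful only if the targets are reached infinitely often, since \<^const>\<open>enumerate\<close>
  is not specified beyond the size of a finite set. The compressor of a two-state rotor
  type does reach its targets infinitely often: each of the two states recurs, so the
  particle cannot be sent back to the source forever.
\<close>

definition hitting_sequence :: "'v \<Rightarrow> 'v set \<Rightarrow> ('v \<Rightarrow> nat \<Rightarrow> 'v) \<Rightarrow> nat \<Rightarrow> 'v" where
  "hitting_sequence s T e k =
     rotor_walk s T e (enumerate {t. rotor_walk s T e t \<in> T} k)"

datatype variant = Variant_U | Variant_D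

fun side_move :: "variant \<Rightarrow> nat \<Rightarrow> nat \<Rightarrow> nat" where
  "side_move Variant_U tgt x = (if x = 1 then 1 else tgt)"
| "side_move Variant_D tgt x = (if x = 1 then tgt else 1)"

text \<open>Vertices are \<open>1\<close> (source), \<open>2\<close>, \<open>3\<close>; the targets are \<open>4\<close> and \<open>5\<close>.\<close>

definition compressor :: "variant \<Rightarrow> variant \<Rightarrow> (nat \<Rightarrow> nat) \<Rightarrow> nat \<Rightarrow> nat \<Rightarrow> nat" where
  "compressor a b r v j =
     (if v = 1 then (if r j = 1 then 2 else 3)
      else if v = 2 then side_move a 4 (r j)
      else side_move b 5 (r j))"

definition UD :: "(nat \<Rightarrow> nat) \<Rightarrow> nat \<Rightarrow> nat" where
  "UD r = hitting_sequence 1 {4, 5} (compressor Variant_U Variant_D r)"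

definition DU :: "(nat \<Rightarrow> nat) \<Rightarrow> nat \<Rightarrow> nat" where
  "DU r = hitting_sequence 1 {4, 5} (compressor Variant_D Variant_U r)"

end

theory Submission
  imports Defs
begin

text \<open>
  Cut the walk of the compressor at the successive departures from the source. The first
  \<open>2nk\<close> departures send \<open>nk\<close> particles to each of the vertices 2 and 3, because \<open>r\<close> is
  \<open>2n\<close>-balanced. Vertex 2 therefore releases as many particles into target 4 as there are
  symbols of one kind among the first \<open>nk\<close> entries of \<open>r\<close>, and since the variants at 2 and 3
  differ, vertex 3 releases as many into target 5 as there are symbols of the other kind.
  So exactly \<open>nk\<close> hits have occurred, distributed over the two targets like the symbols of
  \<open>r\<close>; taking differences in \<open>k\<close> gives the claim for each block of length \<open>n\<close>.
\<close>

section \<open>Prefix counts of symbols and their link with n-equivalence\<close>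

definition occurrences :: "(nat \<Rightarrow> 'a) \<Rightarrow> 'a \<Rightarrow> nat \<Rightarrow> nat" where
  "occurrences u x m = count_list (map u [0..<m]) x"

lemma occurrences_0 [simp]: "occurrences u x 0 = 0"
  by (simp add: occurrences_def)

lemma occurrences_Suc [simp]:
  "occurrences u x (Suc m) = occurrences u x m + (if u m = x then 1 else 0)"
  by (simp add: occurrences_def)

lemma occurrences_notin_range: "x \<notin> range u \<Longrightarrow> occurrences u x m = 0"
  by (induction m) auto

lemma occurrences_pair:
  assumes "range u \<subseteq> {x, y}" "x \<noteq> y"
  shows "occurrences u x m + occurrences u y m = m"
proof (induction m)
  case (Suc m)
  have "u m = x \<or> u m = y" using assms(1) by auto
  then show ?case using Suc assms(2) by auto
qed simp

lemma occurrences_periodic: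
  assumes "\<And>i. u (i + p) = u i"
  shows "occurrences u x (m + p) = occurrences u x m + occurrences u x p"
  by (induction m) (auto simp: assms)

lemma occurrences_block:
  "occurrences u x (k * n) + count_list (block u k n) x = occurrences u x (Suc k * n)"
proof -
  have "[0..<Suc k * n] = [0..<k * n] @ [k * n..<k * n + n]"
    by (metis add.commute le0 mult_Suc upt_add_eq_append)
  then show ?thesis by (simp add: occurrences_def block_def)
qed

text \<open>Every index \<open>i\<close> lies in block \<open>i div n\<close>, so the range is the
  union of the blocks. This supplies the equality of states required by
  \<open>n_equiv\<close>.\<close>

lemma range_eq_of_block_mset_eq:
  assumes "n > 0" "\<And>k. mset (block u k n) = mset (block v k n)"
  shows "range u = range v"
proof -
  have *: "range w = (\<Union>k. set_mset (mset (block w k n)))" for w :: "nat \<Rightarrow> 'a"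
  proof -
    have "w i \<in> set (block w (i div n) n)" for i
      using assms(1) dividend_less_div_times[of n i] by (auto simp: block_def)
    then show ?thesis by (auto simp: block_def)
  qed
  show ?thesis unfolding * using assms(2) by simp
qed

text \<open>The witness relabels \<open>a\<close> to \<open>c\<close> and \<open>b\<close> to
  \<open>d\<close>. With two symbols, the prefix count of one determines that of the other, and
  differences of prefix counts at consecutive multiples of \<open>n\<close> are the counts in one
  block.\<close>

lemma n_equiv_of_occurrences_eq:
  fixes u :: "nat \<Rightarrow> 'a" and v :: "nat \<Rightarrow> 'b"
  assumes n: "n > 0"
    and u: "rotor_type u" "range u \<subseteq> {a, b}" "a \<noteq> b"
    and v: "rotor_type v" "range v \<subseteq> {c, d}" "c \<noteq> d"
    and eq: "\<And>k. occurrences u a (k * n) = occurrences v c (k * n)"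
  shows "n_equiv n u v"
proof -
  define f where "f = (\<lambda>x. if x = a then c else d)"
  define s where "s = f \<circ> u"
  have inj: "inj_on f (range u)"
    using u v(3) by (auto simp: inj_on_def f_def split: if_splits)
  have s_range: "range s \<subseteq> {c, d}" by (auto simp: s_def f_def)
  have occ_c: "occurrences s c (k * n) = occurrences v c (k * n)" for k
  proof -
    have "occurrences s c m = occurrences u a m" for m
      using v(3) by (induction m) (auto simp: s_def f_def)
    then show ?thesis using eq by simp
  qed
  have occ: "occurrences s x (k * n) = occurrences v x (k * n)" for k x
  proof -
    have "occurrences s d (k * n) = occurrences v d (k * n)"
      using occ_c[of k] occurrences_pair[OF s_range v(3), of "k * n"]
        occurrences_pair[OF v(2,3), of "k * n"] by linarith
    moreover have "occurrences s x (k * n) = occurrences v x (k * n)" if "x \<notin> {c, d}"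
      using occurrences_notin_range[of x] that s_range v(2) by (metis subsetD)
    ultimately show ?thesis using occ_c by blast
  qed
  have mset_eq: "mset (block v k n) = mset (block s k n)" for k
  proof (rule multiset_eqI)
    fix x
    show "count (mset (block v k n)) x = count (mset (block s k n)) x"
      using occurrences_block[of s x k n] occurrences_block[of v x k n]
        occ[of x k] occ[of x "Suc k"] by (simp add: count_mset)
  qed
  have "rotor_type s" using u(1) by (auto simp: rotor_type_def s_def)
  moreover have "equiv_rotor u s" using inj by (auto simp: equiv_rotor_def s_def)
  moreover have "range s = range v"
    using range_eq_of_block_mset_eq[of n v s] n mset_eq by simp
  ultimately show ?thesis
    using u(1) v(1) mset_eq unfolding n_equiv_def by blast
qed

section \<open>Hitting sequences as filtered prefixes of the walk\<close>

lemma enumerate_length_filter: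
  fixes S :: "nat set"
  assumes "infinite S" "t \<in> S"
  shows "enumerate S (length (filter (\<lambda>u. u \<in> S) [0..<t])) = t"
proof -
  obtain k where k: "enumerate S k = t" using enumerate_Ex[OF assms] by blast
  \<comment> \<open>As \<open>enumerate S\<close> is strictly increasing, the elements of
    \<open>S\<close> below \<open>enumerate S k\<close> are its values at the indices below
    \<open>k\<close>.\<close>
  have "set (filter (\<lambda>u. u \<in> S) [0..<t]) = enumerate S ` {..<k}"
  proof (intro set_eqI iffI)
    fix x assume "x \<in> set (filter (\<lambda>u. u \<in> S) [0..<t])"
    then have x: "x < t" "x \<in> S" by auto
    then obtain j where "enumerate S j = x" using enumerate_Ex[OF assms(1)] by blast
    then show "x \<in> enumerate S ` {..<k}"
      using x k enumerate_mono_iff[OF assms(1)] by auto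
  next
    fix x assume "x \<in> enumerate S ` {..<k}"
    then show "x \<in> set (filter (\<lambda>u. u \<in> S) [0..<t])"
      using k enumerate_mono_iff[OF assms(1)] enumerate_in_set[OF assms(1)] by auto
  qed
  then have "length (filter (\<lambda>u. u \<in> S) [0..<t]) = card (enumerate S ` {..<k})"
    using distinct_card[of "filter (\<lambda>u. u \<in> S) [0..<t]"] by simp
  also have "\<dots> = k"
    using inj_enumerate[OF assms(1)] by (simp add: card_image inj_on_subset)
  finally show ?thesis using k by simp
qed

text \<open>A hit at time \<open>t\<close> has as its index the number of earlier hits. This trades
  \<open>enumerate\<close> for finite lists that can be built excursion by excursion.\<close>

lemma map_hitting_sequence:
  assumes "infinite {t. rotor_walk s T e t \<in> T}"
  defines "hits t \<equiv> filter (\<lambda>v. v \<in> T) (map (rotor_walk s T e) [0..<t])"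
  shows "map (hitting_sequence s T e) [0..<length (hits t)] = hits t"
proof (induction t)
  case (Suc t)
  have "hitting_sequence s T e (length (hits t)) = rotor_walk s T e t"
    if "rotor_walk s T e t \<in> T"
    using enumerate_length_filter[OF assms(1), of t] that
    by (simp add: hitting_sequence_def hits_def filter_map comp_def)
  then show ?case using Suc by (auto simp: hits_def)
qed (simp add: hits_def)

section \<open>Excursions of the compressor from the source\<close>

fun hit_state :: "variant \<Rightarrow> nat" where
  "hit_state Variant_U = 2"
| "hit_state Variant_D = 1"

context
  fixes a b :: variant and r :: "nat \<Rightarrow> nat"
  assumes r_range: "range r \<subseteq> {1, 2}"
begin

text \<open>Vertex 2 is entered exactly when the source reads symbol 1, so before excursion
  \<open>m\<close> (counted from 0) it has been left \<open>occurrences r 1 m\<close> times;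
  likewise vertex 3 with symbol 2. The value 1 stands for a return without a hit.\<close>

definition excursion_end :: "nat \<Rightarrow> nat" where
  "excursion_end m = (if r m = 1 then side_move a 4 (r (occurrences r 1 m))
     else side_move b 5 (r (occurrences r 2 m)))"

definition excursion_hits :: "nat \<Rightarrow> nat list" where
  "excursion_hits m = filter (\<lambda>v. v \<in> {4, 5}) (map excursion_end [0..<m])"

text \<open>The time of departure \<open>m\<close> from the source, counted from 0: an excursion
  that hits a target costs a third step, the return to the source.\<close>

fun excursion_start :: "nat \<Rightarrow> nat" where
  "excursion_start 0 = 0"
| "excursion_start (Suc m) = excursion_start m + (if excursion_end m = 1 then 2 else 3)"

abbreviation walk :: "nat \<Rightarrow> nat" where
  "walk \<equiv> rotor_walk 1 {4, 5} (compressor a b r)"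

abbreviation hitting :: "nat \<Rightarrow> nat" where
  "hitting \<equiv> hitting_sequence 1 {4, 5} (compressor a b r)"

lemma r_cases: "r i = 1 \<or> r i = 2"
  using r_range by auto

lemma side_move_cases: "side_move v t x = 1 \<or> side_move v t x = t"
  by (cases v) auto

lemma side_move_eq_target: "t \<noteq> 1 \<Longrightarrow> side_move v t (r i) = t \<longleftrightarrow> r i = hit_state v"
  using r_cases[of i] by (cases v) auto

lemma excursion_end_cases: "excursion_end m = 1 \<or> excursion_end m = 4 \<or> excursion_end m = 5"
  using side_move_cases by (auto simp: excursion_end_def)

text \<open>One excursion is simulated step by step. The counters keep their form with
  \<open>Suc m\<close> for \<open>m\<close>, so the last claim is the induction step of
  \<open>state_at_excursion_start\<close>.\<close>

lemma excursion:
  defines "step \<equiv> rotor_step 1 {4, 5} (compressor a b r)"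
  assumes state: "(step ^^ t) (1, \<lambda>_. 0) = (1, c)"
    and c: "c 1 = m" "c 2 = occurrences r 1 m" "c 3 = occurrences r 2 m"
  shows "walk t = 1" "walk (Suc t) \<in> {2, 3}" "walk (Suc (Suc t)) = excursion_end m"
    "\<exists>c'. (step ^^ (t + (if excursion_end m = 1 then 2 else 3))) (1, \<lambda>_. 0) = (1, c') \<and>
      c' 1 = Suc m \<and> c' 2 = occurrences r 1 (Suc m) \<and> c' 3 = occurrences r 2 (Suc m)"
proof -
  \<comment> \<open>\<open>w\<close> is the side vertex visited; \<open>c1\<close> and
    \<open>c2\<close> are the counters after leaving the source and then \<open>w\<close>.\<close>
  define w :: nat where "w = (if r m = 1 then 2 else 3)"
  define c1 where "c1 = c(1 := Suc m)"
  define c2 where "c2 = c1(w := Suc (c1 w))"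
  have 1: "(step ^^ Suc t) (1, \<lambda>_. 0) = (w, c1)"
    using state c by (simp add: step_def rotor_step_def compressor_def w_def c1_def)
  have 2: "(step ^^ Suc (Suc t)) (1, \<lambda>_. 0) = (excursion_end m, c2)"
    using c unfolding funpow.simps(2)[of "Suc t"] comp_apply 1
    by (auto simp: step_def rotor_step_def compressor_def w_def c1_def c2_def excursion_end_def)
  have 3: "(step ^^ Suc (Suc (Suc t))) (1, \<lambda>_. 0) = (1, c2)" if "excursion_end m \<noteq> 1"
    using that excursion_end_cases[of m] unfolding funpow.simps(2)[of "Suc (Suc t)"] comp_apply 2
    by (auto simp: step_def rotor_step_def)
  have c2: "c2 1 = Suc m \<and> c2 2 = occurrences r 1 (Suc m) \<and> c2 3 = occurrences r 2 (Suc m)"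
    using c r_cases[of m] by (auto simp: c2_def c1_def w_def)
  show "walk t = 1" using state by (simp add: rotor_walk_def step_def)
  show "walk (Suc t) \<in> {2, 3}" using 1 by (simp add: rotor_walk_def step_def w_def)
  show "walk (Suc (Suc t)) = excursion_end m"
    using 2 by (simp add: rotor_walk_def step_def)
  show "\<exists>c'. (step ^^ (t + (if excursion_end m = 1 then 2 else 3))) (1, \<lambda>_. 0) = (1, c') \<and>
      c' 1 = Suc m \<and> c' 2 = occurrences r 1 (Suc m) \<and> c' 3 = occurrences r 2 (Suc m)"
  proof (intro exI[of _ c2] conjI)
    show "(step ^^ (t + (if excursion_end m = 1 then 2 else 3))) (1, \<lambda>_. 0) = (1, c2)"
      using 2 3 by (simp add: numeral_2_eq_2 numeral_3_eq_3 del: funpow.simps)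
  qed (use c2 in auto)
qed

lemma state_at_excursion_start:
  "\<exists>c. (rotor_step 1 {4, 5} (compressor a b r) ^^ excursion_start m) (1, \<lambda>_. 0) = (1, c) \<and>
     c 1 = m \<and> c 2 = occurrences r 1 m \<and> c 3 = occurrences r 2 m"
proof (induction m)
  case (Suc m)
  then obtain c where
    "(rotor_step 1 {4, 5} (compressor a b r) ^^ excursion_start m) (1, \<lambda>_. 0) = (1, c)"
    "c 1 = m" "c 2 = occurrences r 1 m" "c 3 = occurrences r 2 m"
    by blast
  then show ?case using excursion(4) by (simp only: excursion_start.simps)
qed simp

lemma filter_walk:
  "filter (\<lambda>v. v \<in> {4, 5}) (map walk [0..<excursion_start m]) = excursion_hits m"
proof (induction m)
  case (Suc m)
  obtain c where
    "(rotor_step 1 {4, 5} (compressor a b r) ^^ excursion_start m) (1, \<lambda>_. 0) = (1, c)"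
    "c 1 = m" "c 2 = occurrences r 1 m" "c 3 = occurrences r 2 m"
    using state_at_excursion_start[of m] by blast
  note walk = excursion(1-3)[OF this]
  \<comment> \<open>If the excursion ends at 1, the time \<open>excursion_start m + 2\<close>
    already opens the next one; otherwise it is the time of the hit.\<close>
  have "[0..<excursion_start (Suc m)] = [0..<excursion_start m] @
      [excursion_start m, Suc (excursion_start m)] @
      (if excursion_end m = 1 then [] else [Suc (Suc (excursion_start m))])"
    by (simp add: numeral_2_eq_2 numeral_3_eq_3)
  then show ?case
    using Suc walk by (auto simp: excursion_hits_def simp del: excursion_start.simps)
qed (simp add: excursion_hits_def)

text \<open>Vertex 2 reads an initial segment of \<open>r\<close>, one entry per visit, and feeds
  target 4 exactly at the entries \<open>hit_state a\<close>; likewise vertex 3, target 5 and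
  \<open>hit_state b\<close>.\<close>

lemma count_excursion_hits:
  "count_list (excursion_hits m) 4 = occurrences r (hit_state a) (occurrences r 1 m)"
  "count_list (excursion_hits m) 5 = occurrences r (hit_state b) (occurrences r 2 m)"
proof (induction m)
  case (Suc m)
  note move = side_move_cases[of a 4 "r (occurrences r 1 m)"]
    side_move_cases[of b 5 "r (occurrences r 2 m)"]
    side_move_eq_target[of 4 a "occurrences r 1 m"]
    side_move_eq_target[of 5 b "occurrences r 2 m"]
  { case 1 then show ?case
      using Suc r_cases[of m] move by (auto simp: excursion_hits_def excursion_end_def) }
  { case 2 then show ?case
      using Suc r_cases[of m] move by (auto simp: excursion_hits_def excursion_end_def) }
qed (auto simp: excursion_hits_def)

lemma length_excursion_hits:
  "length (excursion_hits m) = occurrences r (hit_state a) (occurrences r 1 m)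
     + occurrences r (hit_state b) (occurrences r 2 m)"
proof -
  have "length (excursion_hits m)
      = count_list (excursion_hits m) 4 + count_list (excursion_hits m) 5"
    unfolding excursion_hits_def by (induction m) auto
  then show ?thesis by (simp add: count_excursion_hits)
qed

section \<open>Distinct variants and evenly split prefixes\<close>

context
  fixes n :: nat
  assumes n: "n > 0" and ab: "a \<noteq> b"
    and half: "\<And>x k. x \<in> {1, 2} \<Longrightarrow> occurrences r x (2 * n * k) = n * k"
begin

text \<open>Both side vertices have read the same first \<open>n * k\<close> entries of
  \<open>r\<close>, and as \<open>a\<close> and \<open>b\<close> differ, each entry gives a hit at
  exactly one of them.\<close>

lemma length_excursion_hits_balanced: "length (excursion_hits (2 * n * k)) = n * k"
proof -
  have "{hit_state a, hit_state b} = {1, 2}" using ab by (cases a; cases b) auto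
  then have "occurrences r (hit_state a) (n * k) + occurrences r (hit_state b) (n * k) = n * k"
    using occurrences_pair[of r "hit_state a" "hit_state b"] r_range
    by (metis One_nat_def doubleton_eq_iff n_not_Suc_n numeral_2_eq_2)
  then show ?thesis by (simp add: length_excursion_hits half)
qed

text \<open>Before time \<open>excursion_start (2 * n * k)\<close> there are \<open>n * k\<close>
  hits, which is too many once \<open>k\<close> exceeds a supposed finite total.\<close>

lemma infinite_hits: "infinite {t. walk t \<in> {4, 5}}"
proof
  assume fin: "finite {t. walk t \<in> {4, 5}}"
  define k where "k = Suc (card {t. walk t \<in> {4, 5}})"
  let ?hit_times = "filter (\<lambda>t. walk t \<in> {4, 5}) [0..<excursion_start (2 * n * k)]"
  have "n * k = length ?hit_times"
    using length_excursion_hits_balanced[of k] filter_walk[of "2 * n * k"]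
    by (metis (no_types, lifting) filter_map length_map comp_apply filter_cong)
  also have "\<dots> = card (set ?hit_times)"
    by (rule distinct_card[symmetric]) simp
  also have "\<dots> \<le> card {t. walk t \<in> {4, 5}}"
    by (rule card_mono[OF fin]) auto
  finally have "n * k < k" by (simp add: k_def)
  then show False using n by simp
qed

lemma map_hitting:
  "map hitting [0..<length (excursion_hits m)] = excursion_hits m"
  using map_hitting_sequence[OF infinite_hits, of "excursion_start m"] by (simp only: filter_walk)

lemma hitting_eq_nth: "k < length (excursion_hits m) \<Longrightarrow> hitting k = excursion_hits m ! k"
  by (metis map_hitting add_0 diff_zero length_upt nth_map nth_upt)

lemma occurrences_hitting:
  "occurrences hitting 4 (n * k) = occurrences r (hit_state a) (n * k)"
  "occurrences hitting 5 (n * k) = occurrences r (hit_state b) (n * k)"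
  using map_hitting[of "2 * n * k"] count_excursion_hits[of "2 * n * k"]
  unfolding occurrences_def[of hitting] by (simp_all add: length_excursion_hits_balanced half)

lemma hitting_in_targets: "range hitting \<subseteq> {4, 5}"
  using enumerate_in_set[OF infinite_hits] by (auto simp: hitting_sequence_def)

text \<open>During \<open>p\<close> departures from the source each side vertex advances by only
  half of \<open>p\<close>, which need not be a period of \<open>r\<close>; during
  \<open>2 * p\<close> it advances by \<open>p\<close>. So excursions repeat with period
  \<open>2 * p\<close>, and as these yield \<open>p\<close> hits, \<open>p\<close> is a period of
  the hitting sequence.\<close>

lemma rotor_type_hitting:
  assumes p: "p > 0" "2 * n dvd p" "\<And>i. r (i + p) = r i"
  shows "rotor_type hitting"
proof -
  obtain q where q: "p = n * q" and q2: "2 * p = 2 * n * q" "q > 0"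
    using p(1,2) by (metis dvd_def dvd_mult_right mult.assoc mult.commute gr0I mult_0_right)
  have per2: "r (i + 2 * p) = r i" for i
    using p(3)[of i] p(3)[of "i + p"] by (simp add: mult_2 add.assoc)
  have "occurrences r x (m + 2 * p) = occurrences r x m + p" if "x \<in> {1, 2}" for x m
    using occurrences_periodic[of r "2 * p", OF per2] half[OF that, of q] q q2(1) by metis
  then have "excursion_end (m + 2 * p) = excursion_end m" for m
    by (simp add: excursion_end_def per2 p(3))
  then have split: "excursion_hits (m + 2 * p) = excursion_hits (2 * p) @ excursion_hits m" for m
    by (induction m) (auto simp: excursion_hits_def)
  have len: "length (excursion_hits (2 * p)) = p"
    using length_excursion_hits_balanced[of q] q q2(1) by metis
  have "hitting (k + p) = hitting k" for k
  proof -
    \<comment> \<open>Chosen so that the first \<open>m\<close> excursions give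
      \<open>n * Suc k\<close> hits, enough to cover index \<open>k\<close>.\<close>
    define m where "m = 2 * n * Suc k"
    have "k < n * Suc k" using n by (cases n) auto
    then have k: "k < length (excursion_hits m)"
      by (simp only: m_def length_excursion_hits_balanced)
    then have "hitting (k + p) = excursion_hits (m + 2 * p) ! (k + p)"
      by (intro hitting_eq_nth) (simp add: split len)
    also have "\<dots> = excursion_hits m ! k"
      by (simp add: split len nth_append)
    finally show ?thesis using hitting_eq_nth[OF k] by simp
  qed
  then show ?thesis using p(1) unfolding rotor_type_def by blast
qed

end

end

section \<open>Balanced rotor types and the two compressors\<close>

lemma fund_period:
  assumes "rotor_type r"
  shows "fund_period r > 0" "r (i + fund_period r) = r i"
  using LeastI_ex[OF assms[unfolded rotor_type_def]] by (auto simp: fund_period_def)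

lemma occurrences_balanced:
  assumes "balanced N r" "x \<in> {1, 2}"
  shows "2 * occurrences r x (N * k) = N * k"
proof -
  have "occurrences r 1 (N * k) = occurrences r 2 (N * k)"
  proof (induction k)
    case (Suc k)
    have "count_list (block r k N) 1 = count_list (block r k N) 2"
      using assms(1) by (simp add: balanced_def)
    then show ?case
      using Suc occurrences_block[of r 1 k N] occurrences_block[of r 2 k N]
      by (simp add: mult.commute)
  qed simp
  moreover have "occurrences r 1 (N * k) + occurrences r 2 (N * k) = N * k"
    using assms(1) by (intro occurrences_pair) (auto simp: balanced_def two_state_def)
  ultimately show ?thesis using assms(2) by auto
qed

theorem theorem7p5:
  fixes r :: "nat \<Rightarrow> nat" and n :: nat
  assumes "balanced (2 * n) r"
  shows "n_equiv n (UD r) (DU r) \<and> n_equiv n (DU r) r"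
proof -
  have r: "rotor_type r" "range r \<subseteq> {1, 2}" "2 * n dvd fund_period r"
    using assms by (auto simp: balanced_def two_state_def)
  note period = fund_period[OF r(1)]
  have n: "n > 0" using r(3) period(1) by (cases n) auto
  have half: "occurrences r x (2 * n * k) = n * k" if "x \<in> {1, 2}" for x k
    using occurrences_balanced[OF assms that, of k] by simp
  \<comment> \<open>The target counted is the one behind the vertex of variant \<open>D\<close>,
    which is reached on symbol 1: target 5 for \<open>UD\<close>, target 4 for
    \<open>DU\<close>.\<close>
  have UD: "rotor_type (UD r)" "range (UD r) \<subseteq> {4, 5}"
      "occurrences (UD r) 5 (k * n) = occurrences r 1 (k * n)" for k
    using rotor_type_hitting[OF r(2) n _ half period(1) r(3) period(2), of Variant_U Variant_D]
      hitting_in_targets[OF r(2) n _ half, of Variant_U Variant_D]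
      occurrences_hitting(2)[OF r(2) n _ half, of Variant_U Variant_D k]
    by (auto simp: UD_def mult.commute)
  have DU: "rotor_type (DU r)" "range (DU r) \<subseteq> {4, 5}"
      "occurrences (DU r) 4 (k * n) = occurrences r 1 (k * n)" for k
    using rotor_type_hitting[OF r(2) n _ half period(1) r(3) period(2), of Variant_D Variant_U]
      hitting_in_targets[OF r(2) n _ half, of Variant_D Variant_U]
      occurrences_hitting(1)[OF r(2) n _ half, of Variant_D Variant_U k]
    by (auto simp: DU_def mult.commute)
  \<comment> \<open>The relabeling swaps the targets: 5 in \<open>UD r\<close> and 4 in
    \<open>DU r\<close> both follow the 1's of \<open>r\<close>.\<close>
  have "n_equiv n (UD r) (DU r)"
    using UD DU by (intro n_equiv_of_occurrences_eq[OF n, of _ 5 4 _ 4 5]) auto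
  moreover have "n_equiv n (DU r) r"
    using DU r by (intro n_equiv_of_occurrences_eq[OF n, of _ 4 5 _ 1 2]) auto
  ultimately show ?thesis by blast
qed

end
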